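(* Let $n\in\mathbb{N}$ and let $m\in\mathbb{N}_0$ be even. Then for all real numbers $x_i\ge 1$, $i=1,2,\dots,n$, $$\beta^{(m)}\left(\prod_{i=1}^n x_i\right)\le\left(\prod_{i=1}^n\beta^{(m)}(x_i)\right)^{\frac1n}.$$
   Context: Nielsen's $\beta$-function is the function $\beta:(0,\infty)\to\mathbb{R}$ defined by $\beta(x)=\int_0^1 \frac{t^{x-1}}{1+t}\,dt=\int_0^\infty\frac{e^{-xt}}{1+e^{-t}}\,dt$ for $x>0$. For $m\in\mathbb{N}_0$, $\beta^{(m)}$ denotes its $m$-th derivative, with $\beta^{(0)}=\beta$. Here $\mathbb{N}=\{1,2,3,\dots\}$ and $\mathbb{N}_0=\mathbb{N}\cup\{0\}$. *)

theory Defs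
  imports "HOL-Analysis.Analysis"
begin

text \<open>Nielsen's beta function is only meaningful on the open half-line \<open>x > 0\<close>. The integral is
  a Henstock--Kurzweil integral; for \<open>x > 0\<close> the integrand is nonnegative and absolutely
  integrable, so it agrees with the Lebesgue integral. For \<open>x < 1\<close> the singular endpoint
  contributes nothing, since \<open>0 powr (x - 1) = 0\<close>.\<close>

definition nielsen_beta :: "real \<Rightarrow> real" where
  "nielsen_beta x = integral {0..1} (\<lambda>t. t powr (x - 1) / (1 + t))"

text \<open>At points of the open half-line, the values outside it do not affect the iterated
  derivatives.\<close>

definition nielsen_beta_deriv :: "nat \<Rightarrow> real \<Rightarrow> real" where
  "nielsen_beta_deriv m = (deriv ^^ m) nielsen_beta"

end

theory Submission imports Defs begin

text \<open>
  The inequality holds because \<open>\<beta>\<^sup>(\<^sup>m\<^sup>)\<close> is positive and decreasing on the open half-line when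
  \<open>m\<close> is even. If all \<open>x\<^sub>i\<close> are at least 1, then their product dominates each of them, so
  \<open>\<beta>\<^sup>(\<^sup>m\<^sup>)\<close> at the product is at most each \<open>\<beta>\<^sup>(\<^sup>m\<^sup>)(x\<^sub>i)\<close>, and hence at most the geometric mean of these
  \<open>n\<close> positive numbers (\<open>antimono_prod_le_geometric_mean\<close>).

  Sign and monotonicity are read off from the closed form
  \<open>\<beta>(x) = (\<psi>((x + 1) / 2) - \<psi>(x / 2)) / 2\<close> with the digamma function \<open>\<psi>\<close>
  (\<open>nielsen_beta_eq_digamma_diff\<close>): each derivative of \<open>\<beta>\<close> becomes a difference of values of one
  polygamma function, and on the positive half-line the polygamma functions alternate between
  increasing (even order) and decreasing (odd order).

  The closed form is a uniqueness statement. Both sides satisfy \<open>f(x) + f(x + 1) = 1 / x\<close>, so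
  their difference only changes sign under \<open>x \<mapsto> x + 1\<close>; both sides are nonnegative, hence by
  the same equation at most \<open>1 / x\<close>, so the difference tends to 0 along \<open>x, x + 1, x + 2, \<dots>\<close> and therefore vanishes.
\<close>

lemma nielsen_beta_integrand_integrable:
  fixes x :: real
  assumes "x > 0"
  shows "(\<lambda>t. t powr (x - 1) / (1 + t)) integrable_on {0..1}"
proof (rule measurable_bounded_by_integrable_imp_integrable)
  have "(\<lambda>t. t powr (x - 1) / (1 + t)) \<in> borel_measurable lebesgue"
    by (intro measurable_completion) measurable
  then show "(\<lambda>t. t powr (x - 1) / (1 + t)) \<in> borel_measurable (lebesgue_on {0..1})"
    by (rule measurable_restrict_space1)
  show "(\<lambda>t. t powr (x - 1)) integrable_on {0..1}"
    using has_integral_powr_from_0[of "x - 1" 1] assms by (auto simp: integrable_on_def)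
  show "norm (t powr (x - 1) / (1 + t)) \<le> t powr (x - 1)" if "t \<in> {0..1}" for t
    using that by (simp add: pos_divide_le_eq mult_le_cancel_left1)
qed auto

lemma nielsen_beta_nonneg:
  fixes x :: real
  assumes "x > 0"
  shows "nielsen_beta x \<ge> 0"
  unfolding nielsen_beta_def
  by (rule integral_nonneg[OF nielsen_beta_integrand_integrable[OF assms]]) auto

text \<open>The integrands of \<open>\<beta>(x)\<close> and \<open>\<beta>(x + 1)\<close> add up to \<open>t powr (x - 1)\<close>, because the factor
  \<open>1 + t\<close> cancels.\<close>

lemma nielsen_beta_plus1:
  fixes x :: real
  assumes "x > 0"
  shows "nielsen_beta x + nielsen_beta (x + 1) = 1 / x"
proof -
  have "nielsen_beta x + nielsen_beta (x + 1) =
    integral {0..1} (\<lambda>t. t powr (x - 1) / (1 + t) + t powr (x + 1 - 1) / (1 + t))"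
    unfolding nielsen_beta_def
    by (intro integral_add[symmetric] nielsen_beta_integrand_integrable) (use assms in auto)
  also have "\<dots> = integral {0..1} (\<lambda>t. t powr (x - 1))"
  proof (rule integral_cong)
    fix t :: real assume t: "t \<in> {0..1}"
    have "t powr (x + 1 - 1) = t powr (x - 1) * t"
    proof (cases "t = 0")
      case False
      then show ?thesis using t powr_add[of t "x - 1" 1] by simp
    qed simp
    then have "t powr (x - 1) / (1 + t) + t powr (x + 1 - 1) / (1 + t)
        = t powr (x - 1) * (1 + t) / (1 + t)"
      by (simp only: add_divide_distrib distrib_left mult_1_right)
    then show "t powr (x - 1) / (1 + t) + t powr (x + 1 - 1) / (1 + t) = t powr (x - 1)"
      using t by simp
  qed
  also have "\<dots> = 1 / x"
    using has_integral_powr_from_0[of "x - 1" 1] assms by (auto dest: integral_unique)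
  finally show ?thesis .
qed

text \<open>For \<open>m = 0\<close> this is the digamma form of \<open>\<beta>\<close>; passing from \<open>m\<close> to \<open>m + 1\<close> differentiates,
  the inner scaling \<open>x / 2\<close> contributing one more factor 1/2.\<close>

definition polygamma_half_diff :: "nat \<Rightarrow> real \<Rightarrow> real" where
  "polygamma_half_diff m x =
     (Polygamma m ((x + 1) / 2) - Polygamma m (x / 2)) / 2 ^ Suc m"

lemma has_derivative_polygamma_half_diff:
  fixes x :: real
  assumes "x > 0"
  shows "(polygamma_half_diff m has_real_derivative polygamma_half_diff (Suc m) x) (at x)"
proof -
  have nz: "(x + 1) / 2 \<notin> \<int>\<^sub>\<le>\<^sub>0" "x / 2 \<notin> \<int>\<^sub>\<le>\<^sub>0"
    using assms by (auto elim!: nonpos_Ints_cases)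
  show ?thesis
    unfolding polygamma_half_diff_def[abs_def]
    by (rule derivative_eq_intros refl nz | simp add: field_simps)+
qed

lemma polygamma_half_diff_pos:
  fixes x :: real
  assumes "x > 0" "even m"
  shows "polygamma_half_diff m x > 0"
  using assms by (simp add: polygamma_half_diff_def Polygamma_real_strict_mono)

lemma polygamma_half_diff_neg:
  fixes x :: real
  assumes "x > 0" "odd m"
  shows "polygamma_half_diff m x < 0"
  using assms by (simp add: polygamma_half_diff_def Polygamma_real_strict_antimono
      divide_neg_pos)

text \<open>For even \<open>m\<close> the derivative has odd order, hence is negative.\<close>

lemma polygamma_half_diff_antimono:
  fixes x y :: real
  assumes "0 < x" "x \<le> y" "even m"
  shows "polygamma_half_diff m y \<le> polygamma_half_diff m x"
proof (rule DERIV_nonpos_imp_nonincreasing[OF assms(2)])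
  fix z assume "x \<le> z" "z \<le> y"
  with assms have "z > 0" by simp
  then show "\<exists>d. (polygamma_half_diff m has_real_derivative d) (at z) \<and> d \<le> 0"
    using has_derivative_polygamma_half_diff polygamma_half_diff_neg[of z "Suc m"] assms(3)
    by (auto intro!: exI less_imp_le)
qed

lemma digamma_half_diff_plus1:
  fixes x :: real
  assumes "x > 0"
  shows "polygamma_half_diff 0 x + polygamma_half_diff 0 (x + 1) = 1 / x"
proof -
  have "(x + 1 + 1) / 2 = x / 2 + 1" by (simp add: field_simps)
  then show ?thesis
    using assms Digamma_plus1[of "x / 2"] by (simp add: polygamma_half_diff_def field_simps)
qed

text \<open>Two nonnegative solutions of \<open>f(x) + f(x + 1) = 1 / x\<close> agree: by nonnegativity of \<open>f(x + 1)\<close>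
  both are bounded by \<open>1 / x\<close>, and the modulus of their difference is 1-periodic.\<close>

lemma nonneg_solution_unique:
  fixes f g :: "real \<Rightarrow> real"
  assumes f0: "\<And>y. y > 0 \<Longrightarrow> f y \<ge> 0" and f1: "\<And>y. y > 0 \<Longrightarrow> f y + f (y + 1) = 1 / y"
    and g0: "\<And>y. y > 0 \<Longrightarrow> g y \<ge> 0" and g1: "\<And>y. y > 0 \<Longrightarrow> g y + g (y + 1) = 1 / y"
    and x: "x > 0"
  shows "f x = g x"
proof -
  have periodic: "\<bar>f (x + real k) - g (x + real k)\<bar> = \<bar>f x - g x\<bar>" for k
  proof (induction k)
    case (Suc k)
    have "f (x + real k + 1) - g (x + real k + 1) = - (f (x + real k) - g (x + real k))"
      using f1[of "x + real k"] g1[of "x + real k"] x by simp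
    then show ?case using Suc by (simp add: add_ac)
  qed simp
  have bound: "\<bar>f x - g x\<bar> \<le> 1 / (x + real k)" for k
    unfolding periodic[of k, symmetric]
    using f0[of "x + real k"] f0[of "x + real k + 1"] g0[of "x + real k"] g0[of "x + real k + 1"]
      f1[of "x + real k"] g1[of "x + real k"] x by linarith
  have "(\<lambda>k. 1 / (x + real k)) \<longlonglongrightarrow> 0"
    by (intro tendsto_divide_0[OF tendsto_const] filterlim_at_top_imp_at_infinity
        filterlim_tendsto_add_at_top[OF tendsto_const] filterlim_real_sequentially)
  then have "\<bar>f x - g x\<bar> \<le> 0"
    by (rule LIMSEQ_le_const) (use bound in auto)
  then show ?thesis by simp
qed

lemma nielsen_beta_eq_digamma_diff:
  fixes x :: real
  assumes "x > 0"
  shows "nielsen_beta x = polygamma_half_diff 0 x"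
  using nielsen_beta_nonneg nielsen_beta_plus1 _ digamma_half_diff_plus1 assms
  by (rule nonneg_solution_unique) (simp_all add: less_imp_le polygamma_half_diff_pos)

lemma nielsen_beta_deriv_eq_polygamma_diff:
  fixes x :: real
  assumes "x > 0"
  shows "nielsen_beta_deriv m x = polygamma_half_diff m x"
  using assms
proof (induction m arbitrary: x)
  case 0
  then show ?case by (simp add: nielsen_beta_deriv_def nielsen_beta_eq_digamma_diff)
next
  case (Suc m)
  have "\<forall>\<^sub>F y in nhds x. y > 0"
    using Suc.prems by (rule order_tendstoD(1)[OF filterlim_ident])
  then have "\<forall>\<^sub>F y in nhds x. nielsen_beta_deriv m y = polygamma_half_diff m y"
    by (rule eventually_mono) (rule Suc.IH)
  then have "deriv (nielsen_beta_deriv m) x = deriv (polygamma_half_diff m) x"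
    by (rule deriv_cong_ev) simp
  also have "\<dots> = polygamma_half_diff (Suc m) x"
    by (rule DERIV_imp_deriv[OF has_derivative_polygamma_half_diff[OF Suc.prems]])
  finally show ?case by (simp add: nielsen_beta_deriv_def)
qed

lemma antimono_prod_le_geometric_mean:
  fixes f :: "real \<Rightarrow> real" and x :: "'a \<Rightarrow> real"
  assumes A: "finite A" "A \<noteq> {}"
    and x: "\<And>i. i \<in> A \<Longrightarrow> x i \<ge> 1"
    and pos: "\<And>y. y \<ge> 1 \<Longrightarrow> f y > 0"
    and anti: "\<And>y z. 1 \<le> y \<Longrightarrow> y \<le> z \<Longrightarrow> f z \<le> f y"
  shows "f (\<Prod>i\<in>A. x i) \<le> (\<Prod>i\<in>A. f (x i)) powr (1 / real (card A))"
proof -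
  define p where "p = (\<Prod>i\<in>A. x i)"
  have p1: "p \<ge> 1" unfolding p_def using x by (rule prod_ge_1)
  have le_p: "x i \<le> p" if "i \<in> A" for i
  proof -
    have "1 \<le> (\<Prod>j\<in>A - {i}. x j)" using x by (intro prod_ge_1) auto
    then have "x i * 1 \<le> x i * (\<Prod>j\<in>A - {i}. x j)"
      using x[OF that] by (intro mult_left_mono) auto
    also have "\<dots> = p" unfolding p_def using A that by (simp add: prod.remove)
    finally show ?thesis by simp
  qed
  have "f p ^ card A = (\<Prod>i\<in>A. f p)" by simp
  also have "\<dots> \<le> (\<Prod>i\<in>A. f (x i))"
    using x le_p anti pos[OF p1] by (intro prod_mono) (auto intro: less_imp_le)
  finally have "(f p ^ card A) powr (1 / real (card A)) \<le> (\<Prod>i\<in>A. f (x i)) powr (1 / real (card A))"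
    using pos[OF p1] by (intro powr_mono2) auto
  moreover have "(f p ^ card A) powr (1 / real (card A)) = f p"
    using A pos[OF p1] by (simp add: powr_realpow[symmetric] powr_powr)
  ultimately show ?thesis by (simp add: p_def)
qed

theorem theorem2p20:
  fixes n m :: nat and x :: "nat \<Rightarrow> real"
  assumes "n \<ge> 1"
    and "even m"
    and "\<And>i. i \<in> {1..n} \<Longrightarrow> x i \<ge> 1"
  shows "nielsen_beta_deriv m (\<Prod>i = 1..n. x i)
           \<le> (\<Prod>i = 1..n. nielsen_beta_deriv m (x i)) powr (1 / real n)"
proof -
  have "nielsen_beta_deriv m (\<Prod>i = 1..n. x i)
      \<le> (\<Prod>i = 1..n. nielsen_beta_deriv m (x i)) powr (1 / real (card {1..n}))"
    using assms by (intro antimono_prod_le_geometric_mean)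
      (auto simp: nielsen_beta_deriv_eq_polygamma_diff polygamma_half_diff_pos
        polygamma_half_diff_antimono)
  then show ?thesis by simp
qed

end
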